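(* For every finite graph $G$ of order $n(G)$, $\iota_{\rm g}(G)\le \frac{1}{2}n(G)$.
   Context: All graphs are finite and simple; $N[S]$ denotes the closed neighborhood of a vertex set $S$. In the isolation game on $G$, Dominator and Staller alternately choose vertices of $G$, Dominator first; if $S$ is the set of already chosen vertices, a vertex $x$ may be chosen only if it equals or is adjacent to some vertex $y$ lying in a component of $G-N[S]$ that has at least one edge. The game ends when no such vertex exists. Dominator wants to minimize the number of chosen vertices, Staller wants to maximize it. $\iota_{\rm g}(G)$ is the number of chosen vertices under optimal play. *)

theory Defs
  imports "Graph_Theory.Graph_Theory" Complex_Main
begin

datatype player = Dominator | Staller

fun opponent :: "player \<Rightarrow> player" where
  "opponent Dominator = Staller"
| "opponent Staller = Dominator"

text \<open>The locale \<open>pair_graph\<close> describes finite simple graphs: an undirected edge between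
  \<open>u\<close> and \<open>v\<close> is the pair of arcs \<open>(u, v)\<close> and \<open>(v, u)\<close>.\<close>

context pair_graph
begin

definition closed_nbhd :: "'a set \<Rightarrow> 'a set" where
  "closed_nbhd S = S \<union> {v \<in> pverts G. \<exists>u\<in>S. u \<rightarrow>\<^bsub>G\<^esub> v}"

definition residual :: "'a set \<Rightarrow> ('a, 'a \<times> 'a) pre_digraph" where
  "residual S = with_proj G \<restriction> (pverts G - closed_nbhd S)"

text \<open>As arcs are symmetric, the strongly connected components of \<open>residual S\<close> are the
  components of the undirected graph.\<close>

definition legal_moves :: "'a set \<Rightarrow> 'a set" where
  "legal_moves S = {x \<in> pverts G.
     \<exists>C \<in> pre_digraph.sccs (residual S). arcs C \<noteq> {} \<and> (\<exists>y \<in> verts C. x = y \<or> x \<rightarrow>\<^bsub>G\<^esub> y)}"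

lemma legal_moves_disjoint:
  assumes "x \<in> legal_moves S"
  shows "x \<in> pverts G - S"
proof -
  from assms obtain C y where x: "x \<in> pverts G" and C: "C \<in> pre_digraph.sccs (residual S)"
    and y: "y \<in> verts C" and xy: "x = y \<or> (x, y) \<in> parcs G"
    by (auto simp: legal_moves_def)
  from C have "verts C \<subseteq> pverts G - closed_nbhd S"
    by (auto dest!: pre_digraph.in_sccs_imp_induced
        simp: induced_subgraph_def subgraph_def residual_def)
  with y have "y \<in> pverts G" "y \<notin> closed_nbhd S" by auto
  with x xy show ?thesis by (auto simp: closed_nbhd_def)
qed

text \<open>\<open>moves_left p S\<close> is the number of vertices still to be chosen under optimal play when
  \<open>S\<close> has been chosen and it is the turn of \<open>p\<close>.\<close>

context
  notes image_cong [fundef_cong]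
begin

function moves_left :: "player \<Rightarrow> 'a set \<Rightarrow> nat" where
  "moves_left p S =
     (if legal_moves S = {} then 0
      else 1 + (case p of
          Dominator \<Rightarrow> Min ((\<lambda>x. moves_left (opponent p) (insert x S)) ` legal_moves S)
        | Staller \<Rightarrow> Max ((\<lambda>x. moves_left (opponent p) (insert x S)) ` legal_moves S)))"
  by pat_completeness auto

end

termination
proof (relation "measure (\<lambda>(p, S). card (pverts G - S))")
  show "wf (measure (\<lambda>(p, S). card (pverts G - S)))" by simp
next
  fix p :: player and S x
  assume "x \<in> legal_moves S"
  then have "x \<in> pverts G - S" by (rule legal_moves_disjoint)
  then have "pverts G - insert x S \<subset> pverts G - S" by blast
  then show "((opponent p, insert x S), p, S) \<in> measure (\<lambda>(p, S). card (pverts G - S))"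
    using pair_finite_verts by (simp add: psubset_card_mono)
  then show "((opponent p, insert x S), p, S) \<in> measure (\<lambda>(p, S). card (pverts G - S))" .
qed

declare moves_left.simps [simp del]

definition game_isolation_number :: nat where
  "game_isolation_number = moves_left Dominator {}"

end

end

theory Submission
  imports Defs
begin

text \<open>Call a vertex live if it lies in a nontrivial component of \<open>G - N[S]\<close>. Every legal move
  kills at least one live vertex. As long as some live vertex has two live neighbours, Dominator
  plays it and kills three live vertices, so that his move and Staller's reply together kill at
  least four. Otherwise the live vertices induce a perfect matching, and from then on every legal
  move kills at least two of them, whoever plays it.\<close>

section \<open>Live vertices\<close>

context pair_graph
begin

text \<open>A component of G - N[S] has an edge iff each of its vertices has a neighbour in G -
  N[S], so this local condition replaces membership in a nontrivial component.\<close>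

definition live :: "'a set \<Rightarrow> 'a set" where
  "live S = {v \<in> pverts G - closed_nbhd S. \<exists>w \<in> pverts G - closed_nbhd S. v \<rightarrow>\<^bsub>G\<^esub> w}"

definition matched :: "'a set \<Rightarrow> bool" where
  "matched S \<longleftrightarrow> (\<forall>v \<in> live S. \<forall>w \<in> live S. \<forall>w' \<in> live S. v \<rightarrow>\<^bsub>G\<^esub> w \<longrightarrow> v \<rightarrow>\<^bsub>G\<^esub> w' \<longrightarrow> w = w')"

lemma finite_live [simp]: "finite (live S)"
  using pair_finite_verts by (simp add: live_def)

lemma live_subset: "live S \<subseteq> pverts G"
  by (auto simp: live_def)

lemma live_obtains_neighbour:
  assumes "v \<in> live S"
  obtains w where "w \<in> live S" "v \<rightarrow>\<^bsub>G\<^esub> w"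
  using assms by (auto simp: live_def intro: arcs_symmetric)

text \<open>N[S] only grows. The inclusion can be strict: a vertex outside N[x] dies when it loses
  its last live neighbour.\<close>

lemma live_insert:
  assumes "x \<in> pverts G"
  shows "live (insert x S) \<subseteq> live S - {v. x = v \<or> x \<rightarrow>\<^bsub>G\<^esub> v}"
  using assms by (auto simp: live_def closed_nbhd_def)

section \<open>Legal moves in terms of live vertices\<close>

lemma sym_digraph_residual: "sym_digraph (residual S)"
proof -
  interpret R: wf_digraph "residual S"
    unfolding residual_def by (rule wellformed_induce_subgraph)
  show ?thesis
  proof
    show "symmetric (residual S)"
      unfolding symmetric_conv residual_def by (auto intro: arcs_symmetric)
  qed
qed

lemma in_sccs_residual_imp_live:
  assumes C: "C \<in> pre_digraph.sccs (residual S)" and "arcs C \<noteq> {}" and y: "y \<in> verts C"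
  shows "y \<in> live S"
proof -
  have ind: "induced_subgraph C (residual S)" and sc: "strongly_connected C"
    using C by (auto elim: pre_digraph.in_sccsE)
  interpret C: wf_digraph C
    using ind by (auto simp: induced_subgraph_def subgraph_def)
  have sub: "verts C \<subseteq> pverts G - closed_nbhd S" "arcs C \<subseteq> parcs G" "tail C = fst" "head C = snd"
    using ind by (auto simp: induced_subgraph_def subgraph_def compatible_def residual_def)
  obtain e where e: "e \<in> arcs C" using \<open>arcs C \<noteq> {}\<close> by blast
  then have "y \<rightarrow>\<^sup>*\<^bsub>C\<^esub> tail C e"
    using sc y by (auto simp: strongly_connected_def)
  \<comment> \<open>Either the walk from \<open>y\<close> to the tail of \<open>e\<close> has a
    first arc, or \<open>y\<close> is that tail and \<open>e\<close> itself leaves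
    \<open>y\<close>.\<close>
  then obtain w where "y \<rightarrow>\<^bsub>C\<^esub> w"
    using e by (cases rule: C.converse_reachable_cases) (auto simp: arcs_ends_conv)
  then have "(y, w) \<in> parcs G" "w \<in> verts C"
    using sub C.adj_in_verts(2) by (auto simp: arcs_ends_conv)
  with y sub show ?thesis by (auto simp: live_def)
qed

lemma live_imp_in_sccs_residual:
  assumes "y \<in> live S"
  shows "\<exists>C \<in> pre_digraph.sccs (residual S). arcs C \<noteq> {} \<and> y \<in> verts C"
proof -
  interpret R: sym_digraph "residual S" by (rule sym_digraph_residual)
  obtain w where yw: "y \<in> pverts G - closed_nbhd S" "w \<in> pverts G - closed_nbhd S" "(y, w) \<in> parcs G"
    using assms by (auto simp: live_def)
  \<comment> \<open>In a symmetric digraph, the vertices reachable from \<open>y\<close> induce its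
    strongly connected component.\<close>
  let ?C = "residual S \<restriction> {v. y \<rightarrow>\<^sup>*\<^bsub>residual S\<^esub> v}"
  have y: "y \<in> verts (residual S)" and arc: "(y, w) \<in> arcs (residual S)"
    and ends: "tail (residual S) = fst" "head (residual S) = snd"
    using yw by (auto simp: residual_def)
  have "y \<rightarrow>\<^bsub>residual S\<^esub> w"
    using R.dominatesI[of "(y, w)" y w] arc by (simp add: arc_to_ends_def ends)
  then have "(y, w) \<in> arcs ?C" using arc y by (auto simp: ends)
  with R.induce_reachable_is_in_sccs[OF y] y show ?thesis
    by (intro bexI[of _ ?C]) auto
qed

lemma legal_moves_eq: "legal_moves S = {x \<in> pverts G. \<exists>y \<in> live S. x = y \<or> x \<rightarrow>\<^bsub>G\<^esub> y}"
  unfolding legal_moves_def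
  using in_sccs_residual_imp_live live_imp_in_sccs_residual by blast

lemma finite_legal_moves [simp]: "finite (legal_moves S)"
  using pair_finite_verts by (simp add: legal_moves_eq)

section \<open>Live vertices killed by one move\<close>

lemma card_live_insert_le:
  assumes "A \<subseteq> live S" "live (insert x S) \<subseteq> live S - A"
  shows "card (live (insert x S)) + card A \<le> card (live S)"
proof -
  have "card (live (insert x S)) \<le> card (live S - A)"
    using assms by (intro card_mono) auto
  moreover have "card (live S - A) = card (live S) - card A" "card A \<le> card (live S)"
    using assms(1) by (simp_all add: card_Diff_subset card_mono finite_subset[OF assms(1)])
  ultimately show ?thesis by linarith
qed

text \<open>One is all that is guaranteed: \<open>x\<close> may already lie in N[S] and have a
  single live neighbour.\<close>

lemma card_live_legal:
  assumes "x \<in> legal_moves S"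
  shows "card (live (insert x S)) + 1 \<le> card (live S)"
proof -
  obtain y where "x \<in> pverts G" "y \<in> live S" "x = y \<or> x \<rightarrow>\<^bsub>G\<^esub> y"
    using assms by (auto simp: legal_moves_eq)
  then show ?thesis
    using card_live_insert_le[of "{y}" S x] live_insert[of x S] by auto
qed

text \<open>Besides the vertex \<open>y\<close> that makes \<open>x\<close> legal, its partner
  \<open>w\<close> dies: even if \<open>w\<close> is not in N[x], it has lost its only live
  neighbour.\<close>

lemma card_live_legal_matched:
  assumes "x \<in> legal_moves S" "matched S"
  shows "card (live (insert x S)) + 2 \<le> card (live S)"
proof -
  obtain y where y: "x \<in> pverts G" "y \<in> live S" "x = y \<or> x \<rightarrow>\<^bsub>G\<^esub> y"
    using assms by (auto simp: legal_moves_eq)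
  obtain w where w: "w \<in> live S" "y \<rightarrow>\<^bsub>G\<^esub> w" using y(2) by (rule live_obtains_neighbour)
  have "y \<noteq> w" using w(2) pair_no_loops by fastforce
  have y': "y \<notin> live (insert x S)" using live_insert[of x S] y by blast
  have "w \<notin> live (insert x S)"
  proof
    assume "w \<in> live (insert x S)"
    then obtain z where z: "z \<in> live (insert x S)" "w \<rightarrow>\<^bsub>G\<^esub> z" by (rule live_obtains_neighbour)
    have "z \<in> live S" using z(1) live_insert[OF y(1)] by blast
    moreover have "w \<rightarrow>\<^bsub>G\<^esub> y" using w(2) by (simp add: arcs_symmetric)
    ultimately have "z = y" using assms(2) w(1) y(2) z(2) unfolding matched_def by blast
    with z(1) y' show False by simp
  qed
  with y' have "live (insert x S) \<subseteq> live S - {y, w}"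
    using live_insert[OF y(1), of S] by blast
  then show ?thesis
    using card_live_insert_le[of "{y, w}" S x] y(2) w(1) \<open>y \<noteq> w\<close> by simp
qed

lemma matched_insert:
  assumes "x \<in> pverts G" "matched S"
  shows "matched (insert x S)"
  using live_insert[OF assms(1), of S] assms(2) unfolding matched_def by blast

lemma not_matched_obtains_move:
  assumes "\<not> matched S"
  obtains x where "x \<in> legal_moves S" "card (live (insert x S)) + 3 \<le> card (live S)"
proof -
  obtain v w w' where v: "v \<in> live S" "w \<in> live S" "w' \<in> live S" "v \<rightarrow>\<^bsub>G\<^esub> w" "v \<rightarrow>\<^bsub>G\<^esub> w'" "w \<noteq> w'"
    using assms by (auto simp: matched_def)
  have "v \<in> pverts G" using v(1) live_subset by blast
  have "v \<noteq> w" "v \<noteq> w'" using v(4,5) pair_no_loops by fastforce+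
  then have "card {v, w, w'} = 3" using v(6) by simp
  moreover have "live (insert v S) \<subseteq> live S - {v, w, w'}"
    using live_insert[OF \<open>v \<in> pverts G\<close>, of S] v by blast
  ultimately have "card (live (insert v S)) + 3 \<le> card (live S)"
    using card_live_insert_le[of "{v, w, w'}" S v] v by simp
  moreover have "v \<in> legal_moves S" using v(1) \<open>v \<in> pverts G\<close> by (auto simp: legal_moves_eq)
  ultimately show thesis by (rule that[rotated])
qed

section \<open>Optimal play\<close>

lemma moves_left_Dominator_le:
  assumes "x \<in> legal_moves S"
  shows "moves_left Dominator S \<le> 1 + moves_left Staller (insert x S)"
  using assms by (subst moves_left.simps) (auto intro!: Min_le)

lemma moves_left_Staller_obtains:
  assumes "legal_moves S \<noteq> {}"
  obtains x where "x \<in> legal_moves S"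
    "moves_left Staller S = 1 + moves_left Dominator (insert x S)"
proof -
  let ?M = "(\<lambda>x. moves_left Dominator (insert x S)) ` legal_moves S"
  have "Max ?M \<in> ?M" using assms by (intro Max_in) auto
  moreover have "moves_left Staller S = 1 + Max ?M"
    using assms by (subst moves_left.simps) simp
  ultimately show thesis using that by auto
qed

lemma moves_left_no_legal_moves: "legal_moves S = {} \<Longrightarrow> moves_left p S = 0"
  by (simp add: moves_left.simps)

text \<open>Treats both players alike: for Dominator any legal \<open>x\<close> will do, for Staller
  a maximizing one gives equality.\<close>

lemma moves_left_obtains:
  assumes "legal_moves S \<noteq> {}"
  obtains x where "x \<in> legal_moves S" "moves_left p S \<le> 1 + moves_left (opponent p) (insert x S)"
proof (cases p)
  case Dominator
  with assms that show thesis using moves_left_Dominator_le by fastforce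
next
  case Staller
  obtain x where "x \<in> legal_moves S" "moves_left Staller S = 1 + moves_left Dominator (insert x S)"
    using assms by (rule moves_left_Staller_obtains)
  with Staller that show thesis by simp
qed

lemma moves_left_matched:
  assumes "matched S"
  shows "2 * moves_left p S \<le> card (live S)"
  using assms
proof (induction "card (live S)" arbitrary: p S rule: less_induct)
  case less
  show ?case
  proof (cases "legal_moves S = {}")
    case True
    then show ?thesis by (simp add: moves_left_no_legal_moves)
  next
    case False
    then obtain x where x: "x \<in> legal_moves S"
      and le: "moves_left p S \<le> 1 + moves_left (opponent p) (insert x S)"
      by (rule moves_left_obtains)
    have card: "card (live (insert x S)) + 2 \<le> card (live S)"
      using x less.prems by (rule card_live_legal_matched)
    have "matched (insert x S)"
      using x less.prems by (auto simp: legal_moves_eq intro: matched_insert)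
    with less.hyps[of "insert x S" "opponent p"] card
    have "2 * moves_left (opponent p) (insert x S) \<le> card (live (insert x S))" by simp
    with card le show ?thesis by linarith
  qed
qed

text \<open>The induction advances a full round, so that Dominator is again to move: at least 3 + 1
  live vertices pay for two moves.\<close>

lemma moves_left_Dominator: "2 * moves_left Dominator S \<le> card (live S)"
proof (induction "card (live S)" arbitrary: S rule: less_induct)
  case less
  show ?case
  proof (cases "matched S")
    case True
    then show ?thesis by (rule moves_left_matched)
  next
    case False
    then obtain x where x: "x \<in> legal_moves S" "card (live (insert x S)) + 3 \<le> card (live S)"
      by (rule not_matched_obtains_move)
    let ?S = "insert x S"
    have le: "moves_left Dominator S \<le> 1 + moves_left Staller ?S"
      using x(1) by (rule moves_left_Dominator_le)
    show ?thesis
    proof (cases "legal_moves ?S = {}")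
      \<comment> \<open>Dominator's move ended the game, and the three live vertices it killed pay
        for it alone.\<close>
      case True
      then show ?thesis using le x(2) by (simp add: moves_left_no_legal_moves)
    next
      case False
      then obtain z where z: "z \<in> legal_moves ?S"
        and eq: "moves_left Staller ?S = 1 + moves_left Dominator (insert z ?S)"
        by (rule moves_left_Staller_obtains)
      have card: "card (live (insert z ?S)) + 1 \<le> card (live ?S)"
        using z by (rule card_live_legal)
      then have "2 * moves_left Dominator (insert z ?S) \<le> card (live (insert z ?S))"
        using x(2) by (intro less.hyps) linarith
      with card x(2) le eq show ?thesis by linarith
    qed
  qed
qed

end

theorem theorem3p2:
  fixes G :: "'a pair_pre_digraph"
  assumes "pair_graph G"
  shows "real (pair_graph.game_isolation_number G) \<le> 1 / 2 * real (card (pverts G))"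
proof -
  interpret pair_graph G by (rule assms)
  \<comment> \<open>Initially the live vertices are the non-isolated ones, so isolated vertices only
    add slack.\<close>
  have "2 * game_isolation_number \<le> card (live {})"
    unfolding game_isolation_number_def by (rule moves_left_Dominator)
  also have "\<dots> \<le> card (pverts G)"
    using pair_finite_verts live_subset by (rule card_mono)
  finally show ?thesis by simp
qed

end
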